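(* Let $A$ be a real $n\times n$ matrix and $B$ a real $n\times d$ matrix such that the input pair $(A,B)$ is stable and controllable. Then $(A,B)$ is similar (equivalent) to a standard Hessenberg input normal (HIN) pair; that is, there is an invertible real $n\times n$ matrix $T$ such that $(T^{-1}AT,\;T^{-1}B)$ is a standard HIN pair.
   Context: All matrices are real; $A^*$ denotes the transpose of $A$. An input pair $(A,B)$ consists of a real $n\times n$ matrix $A$ and a real $n\times d$ matrix $B$. It is stable if all eigenvalues of $A$ lie in the open unit disk (discrete-time stability), and controllable if $(B\,|\,AB\,|\cdots|\,A^{n-1}B)$ has rank $n$. Two pairs $(A,B)$ and $(\tilde A,\tilde B)$ are equivalent (similar) if $\tilde A=T^{-1}AT$ and $\tilde B=T^{-1}B$ for some invertible $T$. A pair $(A,B)$ is input normal if $AA^*+BB^*=I_n$. A pair $(A,B)$ is in Hessenberg form if $A$ is an (upper) Hessenberg matrix ($A_{i,j}=0$ for $i>j+1$), $B_{1,1}\ge 0$, and $B_{j,1}=0$ for $j>1$. A Hessenberg input normal (HIN) pair is a pair that is both in Hessenberg form and input normal. A Hessenberg pair is standard if $A_{i+1,i}\ge 0$ for $1\le i<n$ and $0\le B_{1,1}\le 1$. *)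

theory Defs
  imports "HOL-Analysis.Analysis" "Jordan_Normal_Form.DL_Rank" "Jordan_Normal_Form.Char_Poly"
begin

text \<open>
  The size \<open>n\<close> is a natural number and rows and columns are indexed from 0, so the entry
  written \<open>B\<^sub>1\<^sub>1\<close> on paper is \<open>B $$ (0, 0)\<close> here.
\<close>

definition input_pair :: "nat \<Rightarrow> nat \<Rightarrow> real mat \<Rightarrow> real mat \<Rightarrow> bool" where
  "input_pair n d A B \<longleftrightarrow> A \<in> carrier_mat n n \<and> B \<in> carrier_mat n d"

text \<open>Eigenvalues of a real matrix are taken in the complex numbers.\<close>

definition stable_mat :: "real mat \<Rightarrow> bool" where
  "stable_mat A \<longleftrightarrow> (\<forall>z. eigenvalue (map_mat complex_of_real A) z \<longrightarrow> cmod z < 1)"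

text \<open>The block matrix \<open>(B | AB | \<dots> | A\<^bsup>n-1\<^esup>B)\<close>, as the list of its columns.\<close>

definition controllability_mat :: "nat \<Rightarrow> real mat \<Rightarrow> real mat \<Rightarrow> real mat" where
  "controllability_mat n A B = mat_of_cols n (concat (map (\<lambda>k. cols (A ^\<^sub>m k * B)) [0..<n]))"

definition controllable :: "nat \<Rightarrow> real mat \<Rightarrow> real mat \<Rightarrow> bool" where
  "controllable n A B \<longleftrightarrow> vec_space.rank n (controllability_mat n A B) = n"

text \<open>Here \<open>S\<close> is the inverse of \<open>T\<close>.\<close>

definition equivalent_pairs ::
  "nat \<Rightarrow> real mat \<Rightarrow> real mat \<Rightarrow> real mat \<Rightarrow> real mat \<Rightarrow> bool" where
  "equivalent_pairs n A B A' B' \<longleftrightarrow>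
     (\<exists>T\<in>carrier_mat n n. \<exists>S\<in>carrier_mat n n.
        inverts_mat T S \<and> inverts_mat S T \<and> A' = S * A * T \<and> B' = S * B)"

definition input_normal :: "nat \<Rightarrow> real mat \<Rightarrow> real mat \<Rightarrow> bool" where
  "input_normal n A B \<longleftrightarrow> A * transpose_mat A + B * transpose_mat B = 1\<^sub>m n"

definition hessenberg_mat :: "nat \<Rightarrow> real mat \<Rightarrow> bool" where
  "hessenberg_mat n A \<longleftrightarrow> (\<forall>i<n. \<forall>j<n. i > j + 1 \<longrightarrow> A $$ (i, j) = 0)"

definition hessenberg_pair :: "nat \<Rightarrow> real mat \<Rightarrow> real mat \<Rightarrow> bool" where
  "hessenberg_pair n A B \<longleftrightarrow>
     hessenberg_mat n A \<and> B $$ (0, 0) \<ge> 0 \<and> (\<forall>j<n. j > 0 \<longrightarrow> B $$ (j, 0) = 0)"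

definition HIN_pair :: "nat \<Rightarrow> real mat \<Rightarrow> real mat \<Rightarrow> bool" where
  "HIN_pair n A B \<longleftrightarrow> hessenberg_pair n A B \<and> input_normal n A B"

definition standard_pair :: "nat \<Rightarrow> real mat \<Rightarrow> real mat \<Rightarrow> bool" where
  "standard_pair n A B \<longleftrightarrow>
     hessenberg_pair n A B \<and> (\<forall>i. i + 1 < n \<longrightarrow> A $$ (i + 1, i) \<ge> 0) \<and>
     0 \<le> B $$ (0, 0) \<and> B $$ (0, 0) \<le> 1"

end

theory Submission
  imports Defs "Jordan_Normal_Form.Spectral_Radius"
begin

text \<open>
  For a stable controllable pair the Gramian \<open>P = (\<Sum>k. (A\<^sup>kB)(A\<^sup>kB)\<^sup>T)\<close> converges, is positive
  definite and solves the Stein equation \<open>APA\<^sup>T + BB\<^sup>T = P\<close>. Hence every \<open>T\<close> with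
  \<open>TT\<^sup>T = P\<close>, that is, every \<open>T\<close> whose columns are orthonormal for the inner product
  \<open>x\<^sup>TP\<^bsup>-1\<^esup>y\<close>, makes the pair input normal. The Hessenberg shape comes from choosing these
  columns by the Arnoldi process started at the first column of \<open>B\<close>: \<open>At\<^sub>j\<close> lies in the span of
  \<open>t\<^sub>0, \<dots>, t\<^sub>j\<^sub>+\<^sub>1\<close>, and if the process breaks down (the first column alone need not
  generate the whole space) it continues with an arbitrary unit vector orthogonal to the previous
  ones. The sign of each new vector is free, which gives the standard form.
\<close>

unbundle no inner_syntax
unbundle no vec_syntax

section \<open>Powers of stable matrices\<close>

lemma smult_pow_mat:
  fixes A :: "'a :: comm_semiring_1 mat"
  assumes A: "A \<in> carrier_mat n n"
  shows "(c \<cdot>\<^sub>m A) ^\<^sub>m k = c ^ k \<cdot>\<^sub>m A ^\<^sub>m k"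
proof (induction k)
  case 0
  show ?case using A by (intro eq_matI) auto
next
  case (Suc k)
  then show ?case using A
    by (intro eq_matI) (simp_all add: mult_smult_assoc_mat[of _ n n _ n] mult_smult_distrib[of _ n n _ n] mult.assoc)
qed

lemma pow_mat_Suc_left:
  fixes A :: "'a :: semiring_1 mat"
  assumes A: "A \<in> carrier_mat n n"
  shows "A ^\<^sub>m Suc k = A * A ^\<^sub>m k"
proof (induction k)
  case 0
  show ?case using A by simp
next
  case (Suc k)
  have "A ^\<^sub>m Suc (Suc k) = A * A ^\<^sub>m k * A" using Suc by simp
  also have "\<dots> = A * (A ^\<^sub>m k * A)" using A by (intro assoc_mult_mat) auto
  finally show ?case by simp
qed

lemma smult_mat_mult_vec:
  fixes A :: "'a :: comm_semiring_0 mat"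
  assumes "A \<in> carrier_mat m n" and "v \<in> carrier_vec n"
  shows "(c \<cdot>\<^sub>m A) *\<^sub>v v = c \<cdot>\<^sub>v (A *\<^sub>v v)"
  using assms by (intro eq_vecI) auto

text \<open>Choose \<open>r\<close> strictly between the spectral radius and 1. The rescaled matrix
  \<open>D\<close>, which is \<open>A / r\<close> over the complex numbers, still has spectral
  radius below 1, so by its Jordan form its powers are bounded by a constant; undoing the scaling
  gives geometric decay.\<close>

lemma stable_mat_norm_bound_pow:
  assumes A: "A \<in> carrier_mat n n" and n: "n > 0" and st: "stable_mat A"
  shows "\<exists>c r. 0 < r \<and> r < 1 \<and> (\<forall>k. norm_bound (A ^\<^sub>m k) (c * r ^ k))"
proof -
  define cA where "cA = map_mat complex_of_real A"
  have cA: "cA \<in> carrier_mat n n" using A by (auto simp: cA_def)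
  define \<rho> where "\<rho> = spectral_radius cA"
  have "\<rho> \<in> norm ` spectrum cA"
    unfolding \<rho>_def by (rule spectral_radius_mem_max(1)[OF cA n])
  then obtain z where "eigenvalue cA z" "\<rho> = cmod z" unfolding spectrum_def by auto
  then have \<rho>: "0 \<le> \<rho>" "\<rho> < 1" using st unfolding stable_mat_def cA_def by auto
  \<comment> \<open>The midpoint of the spectral radius and 1 is positive even when \<open>A\<close>
    is nilpotent, so dividing by \<open>r\<close> is safe.\<close>
  define r where "r = (1 + \<rho>) / 2"
  have r: "0 < r" "r < 1" "\<rho> < r" using \<rho> by (auto simp: r_def)
  define D where "D = complex_of_real (1 / r) \<cdot>\<^sub>m cA"
  have D: "D \<in> carrier_mat n n" using cA by (auto simp: D_def)
  have "spectral_radius D < 1"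
  proof -
    obtain w where w: "eigenvalue D w" "spectral_radius D = cmod w"
      using spectral_radius_mem_max(1)[OF D n] unfolding spectrum_def by auto
    then obtain v where v: "v \<in> carrier_vec n" "v \<noteq> 0\<^sub>v n" "D *\<^sub>v v = w \<cdot>\<^sub>v v"
      using D unfolding eigenvalue_def eigenvector_def by auto
    have "cA = complex_of_real r \<cdot>\<^sub>m D"
      using r cA by (intro eq_matI) (auto simp: D_def)
    then have "cA *\<^sub>v v = (complex_of_real r * w) \<cdot>\<^sub>v v"
      using smult_mat_mult_vec[OF D v(1)] v(3) by (simp add: smult_smult_assoc)
    then have "eigenvalue cA (complex_of_real r * w)"
      using v cA unfolding eigenvalue_def eigenvector_def by auto
    then have "cmod (complex_of_real r * w) \<le> \<rho>"
      unfolding \<rho>_def by (intro spectral_radius_mem_max(2)[OF cA n]) (auto simp: spectrum_def)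
    then have "cmod w \<le> \<rho> / r" using r by (simp add: norm_mult field_simps)
    also have "\<dots> < 1" using r by simp
    finally show ?thesis using w(2) by simp
  qed
  then obtain c where c: "\<And>k. norm_bound (D ^\<^sub>m k) c"
    using spectral_radius_jnf_norm_bound_less_1_upper_triangular[OF D] by auto
  have "norm_bound (A ^\<^sub>m k) (c * r ^ k)" for k
  proof
    fix i j assume ij: "i < dim_row (A ^\<^sub>m k)" "j < dim_col (A ^\<^sub>m k)"
    then have ij: "i < n" "j < n" using pow_carrier_mat[OF A, of k] by auto
    have "D ^\<^sub>m k = complex_of_real (1 / r) ^ k \<cdot>\<^sub>m map_mat complex_of_real (A ^\<^sub>m k)"
      unfolding D_def smult_pow_mat[OF cA] by (simp add: cA_def of_real_hom.mat_hom_pow[OF A])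
    then have "(D ^\<^sub>m k) $$ (i, j) = complex_of_real ((1 / r) ^ k * (A ^\<^sub>m k) $$ (i, j))"
      using ij carrier_matD[OF pow_carrier_mat[OF A, of k]] by auto
    moreover have "cmod ((D ^\<^sub>m k) $$ (i, j)) \<le> c"
      using c[of k] ij unfolding norm_bound_def carrier_matD[OF pow_carrier_mat[OF D]] by blast
    ultimately have "\<bar>(1 / r) ^ k * (A ^\<^sub>m k) $$ (i, j)\<bar> \<le> c" by (simp only: norm_of_real)
    then show "norm ((A ^\<^sub>m k) $$ (i, j)) \<le> c * r ^ k"
      using r by (simp add: abs_mult field_simps power_divide)
  qed
  then show ?thesis using r by blast
qed

section \<open>The controllability Gramian\<close>

lemma scalar_prod_self_nonneg: "v \<bullet> v \<ge> 0" for v :: "real vec"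
  by (auto simp: scalar_prod_def intro: sum_nonneg)

lemma scalar_prod_self_eq_0:
  fixes v :: "real vec"
  assumes "v \<in> carrier_vec n"
  shows "v \<bullet> v = 0 \<longleftrightarrow> v = 0\<^sub>v n"
proof
  assume "v \<bullet> v = 0"
  then have "\<forall>i\<in>{0..<n}. v $ i * v $ i = 0"
    using assms by (subst (asm) scalar_prod_def) (simp add: sum_nonneg_eq_0_iff)
  then show "v = 0\<^sub>v n" using assms by (intro eq_vecI) auto
qed auto

text \<open>Rank \<open>n\<close> means that the columns of the controllability matrix span the
  whole space. A vector orthogonal to all of them is then orthogonal to itself.\<close>

lemma controllable_left_kernel:
  assumes A: "A \<in> carrier_mat n n" and B: "B \<in> carrier_mat n d"
    and ctr: "controllable n A B" and x: "x \<in> carrier_vec n"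
    and orth: "\<And>k. transpose_mat (A ^\<^sub>m k * B) *\<^sub>v x = 0\<^sub>v d"
  shows "x = 0\<^sub>v n"
proof -
  interpret vec_space "TYPE(real)" n .
  define C where "C = controllability_mat n A B"
  have W: "A ^\<^sub>m k * B \<in> carrier_mat n d" for k using A B by auto
  have C: "C \<in> carrier_mat n (dim_col C)" by (auto simp: C_def controllability_mat_def)
  have sub: "set (concat (map (\<lambda>k. cols (A ^\<^sub>m k * B)) [0..<n])) \<subseteq> carrier_vec n"
  proof -
    have "set (cols (A ^\<^sub>m k * B)) \<subseteq> carrier_vec n" for k
      using cols_dim W[of k] by (metis carrier_matD(1))
    then show ?thesis by auto
  qed
  then have colsC: "set (cols C) = (\<Union>k<n. set (cols (A ^\<^sub>m k * B)))"
    unfolding C_def controllability_mat_def by (subst cols_mat_of_cols) auto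
  have cc: "set (cols C) \<subseteq> carrier_vec n" using C cols_dim by blast
  \<comment> \<open>A maximal independent set of columns has as many elements as the rank, hence
    \<open>n\<close>, and is therefore a basis.\<close>
  obtain S where S: "maximal S (\<lambda>T. T \<subseteq> set (cols C) \<and> lin_indpt T)" "finite S"
    using maximal_exists_superset[of "set (cols C)" "\<lambda>T. T \<subseteq> set (cols C) \<and> lin_indpt T" "{}"]
    by (auto simp: finite_lin_indpt2)
  then have S': "S \<subseteq> set (cols C)" "lin_indpt S" unfolding maximal_def by auto
  have "card S = n"
    using rank_card_indpt[OF C S(1)] ctr unfolding controllable_def C_def by simp
  then have "basis S" using S' cc S(2) dim_is_n by (intro dim_li_is_basis) auto
  then have "span S = carrier_vec n" unfolding basis_def by auto
  moreover have "x \<in> orthogonal_complement S"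
    unfolding orthogonal_complement_def
  proof (intro CollectI conjI ballI x)
    fix y assume "y \<in> S"
    then obtain k where "y \<in> set (cols (A ^\<^sub>m k * B))" using S' colsC by auto
    then obtain j where j: "j < d" "y = col (A ^\<^sub>m k * B) j"
      using W[of k] by (metis carrier_matD(2) cols_length cols_nth in_set_conv_nth)
    then have "y \<bullet> x = 0"
      using arg_cong[OF orth[of k], of "\<lambda>v. v $ j"] W[of k] B by (simp add: row_transpose)
    then show "x \<bullet> y = 0"
      using S' cc \<open>y \<in> S\<close> x by (subst comm_scalar_prod[of _ n]) auto
  qed
  ultimately have "x \<in> orthogonal_complement (carrier_vec n)"
    using in_orthogonal_complement_span[of S] S' cc by auto
  then have "x \<bullet> x = 0" using x unfolding orthogonal_complement_def by auto
  then show ?thesis using x by (simp add: scalar_prod_self_eq_0)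
qed

text \<open>A bilinear form is a finite combination of matrix entries, so entrywise convergence of a
  series of matrices carries over to it.\<close>

lemma scalar_prod_mat_mult_sums:
  assumes f: "\<And>k. f k \<in> carrier_mat n n" and P: "P \<in> carrier_mat n n"
    and "\<And>i j. i < n \<Longrightarrow> j < n \<Longrightarrow> (\<lambda>k. f k $$ (i, j)) sums (P $$ (i, j))"
    and x: "x \<in> carrier_vec n" and y: "y \<in> carrier_vec n"
  shows "(\<lambda>k. x \<bullet> (f k *\<^sub>v y)) sums (x \<bullet> (P *\<^sub>v y) :: real)"
proof -
  have form: "x \<bullet> (M *\<^sub>v y) = (\<Sum>i\<in>{0..<n}. x $ i * (\<Sum>j\<in>{0..<n}. M $$ (i, j) * y $ j))"
    if "M \<in> carrier_mat n n" for M
    using that x y by (auto simp: scalar_prod_def intro!: sum.cong)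
  show ?thesis unfolding form[OF P] form[OF f]
    by (intro sums_sum sums_mult sums_mult2) (use assms in auto)
qed

lemma scalar_prod_gram:
  fixes W :: "'a :: comm_semiring_0 mat"
  assumes W: "W \<in> carrier_mat n d" and x: "x \<in> carrier_vec n" and y: "y \<in> carrier_vec n"
  shows "x \<bullet> (W * transpose_mat W *\<^sub>v y) = (transpose_mat W *\<^sub>v x) \<bullet> (transpose_mat W *\<^sub>v y)"
proof -
  have "W * transpose_mat W *\<^sub>v y = W *\<^sub>v (transpose_mat W *\<^sub>v y)"
    using W y by (intro assoc_mult_mat_vec) auto
  then show ?thesis
    using transpose_vec_mult_scalar[OF W, of "transpose_mat W *\<^sub>v y" x] W x y by auto
qed

text \<open>Written as a bilinear form, an entry of the sandwich product can be exchanged with the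
  infinite sum by \<open>scalar_prod_mat_mult_sums\<close>.\<close>

lemma sandwich_index:
  fixes A X :: "'a :: comm_semiring_0 mat"
  assumes A: "A \<in> carrier_mat m n" and X: "X \<in> carrier_mat n n" and "i < m" "j < m"
  shows "(A * X * transpose_mat A) $$ (i, j) = row A i \<bullet> (X *\<^sub>v row A j)"
proof -
  have "A * X * transpose_mat A = A * (X * transpose_mat A)"
    using A X by (intro assoc_mult_mat) auto
  then show ?thesis using assms by (simp add: mult_mat_vec_def)
qed

text \<open>Geometric decay of the powers makes the series converge, and controllability makes one
  term of each quadratic form positive. Sandwiching between \<open>A\<close> and its transpose
  shifts the series by one index; the missing first term is
  \<open>B * transpose_mat B\<close>.\<close>

lemma controllability_gramian:
  assumes n: "n > 0" and A: "A \<in> carrier_mat n n" and B: "B \<in> carrier_mat n d"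
    and st: "stable_mat A" and ctr: "controllable n A B"
  shows "\<exists>P \<in> carrier_mat n n. transpose_mat P = P
    \<and> (\<forall>x \<in> carrier_vec n. x \<noteq> 0\<^sub>v n \<longrightarrow> x \<bullet> (P *\<^sub>v x) > 0)
    \<and> A * P * transpose_mat A + B * transpose_mat B = P"
proof -
  define W where "W k = A ^\<^sub>m k * B" for k
  define f where "f k = W k * transpose_mat (W k)" for k
  have W: "W k \<in> carrier_mat n d" for k using A B by (auto simp: W_def)
  have f: "f k \<in> carrier_mat n n" for k using W[of k] by (auto simp: f_def)
  obtain c r where r: "0 < r" "r < 1" and c: "\<And>k. norm_bound (A ^\<^sub>m k) (c * r ^ k)"
    using stable_mat_norm_bound_pow[OF A n st] by auto
  obtain b where b: "norm_bound B b" using norm_bound_max by blast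
  have bW: "norm_bound (W k) (c * r ^ k * b * n)" for k
    unfolding W_def by (rule norm_bound_mult[OF _ B c b]) (use A in auto)
  have summ: "summable (\<lambda>k. f k $$ (i, j))" if ij: "i < n" "j < n" for i j
  proof (rule summable_comparison_test)
    \<comment> \<open>An entry of \<open>f k\<close> is a sum of \<open>d\<close> products of two
      entries of \<open>W k\<close>, each at most \<open>c * r ^ k * b * n\<close> in
      modulus.\<close>
    have "norm (f k $$ (i, j)) \<le> ((c * b * n)\<^sup>2 * d) * (r\<^sup>2) ^ k" for k
    proof -
      have "norm_bound (transpose_mat (W k)) (c * r ^ k * b * n)"
        using bW[of k] unfolding norm_bound_def by auto
      then have "norm_bound (f k) (c * r ^ k * b * n * (c * r ^ k * b * n) * d)"
        unfolding f_def using W[of k] by (intro norm_bound_mult[OF W _ bW]) auto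
      then have "norm (f k $$ (i, j)) \<le> c * r ^ k * b * n * (c * r ^ k * b * n) * d"
        using f[of k] ij unfolding norm_bound_def by auto
      then show ?thesis by (simp add: power2_eq_square power_mult_distrib mult_ac)
    qed
    then show "\<exists>N. \<forall>k\<ge>N. norm (f k $$ (i, j)) \<le> ((c * b * n)\<^sup>2 * d) * (r\<^sup>2) ^ k" by blast
    show "summable (\<lambda>k. ((c * b * n)\<^sup>2 * d) * (r\<^sup>2) ^ k)"
      using r by (intro summable_mult summable_geometric) (auto simp: power_less_one_iff)
  qed
  define P where "P = mat n n (\<lambda>(i, j). \<Sum>k. f k $$ (i, j))"
  have P: "P \<in> carrier_mat n n" by (auto simp: P_def)
  have sm: "(\<lambda>k. f k $$ (i, j)) sums (P $$ (i, j))" if "i < n" "j < n" for i j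
    using summable_sums[OF summ[OF that]] that by (simp add: P_def)
  have "transpose_mat (f k) = f k" for k
    unfolding f_def using W[of k] by (subst transpose_mult) auto
  then have "f k $$ (j, i) = f k $$ (i, j)" if "i < n" "j < n" for i j k
    using that f[of k] by (metis carrier_matD index_transpose_mat(1))
  then have sym: "transpose_mat P = P"
    by (intro eq_matI) (auto simp: P_def)
  have pd: "x \<bullet> (P *\<^sub>v x) > 0" if x: "x \<in> carrier_vec n" and x0: "x \<noteq> 0\<^sub>v n" for x
  proof -
    define g where "g k = x \<bullet> (f k *\<^sub>v x)" for k
    have g: "g sums (x \<bullet> (P *\<^sub>v x))"
      unfolding g_def by (rule scalar_prod_mat_mult_sums[OF f P sm x x])
    have gW: "g k = (transpose_mat (W k) *\<^sub>v x) \<bullet> (transpose_mat (W k) *\<^sub>v x)" for k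
      unfolding g_def f_def by (rule scalar_prod_gram[OF W x x])
    have g0: "g k \<ge> 0" for k unfolding gW by (rule scalar_prod_self_nonneg)
    obtain k where "transpose_mat (W k) *\<^sub>v x \<noteq> 0\<^sub>v d"
      using controllable_left_kernel[OF A B ctr x] x0 unfolding W_def by blast
    then have "g k \<noteq> 0"
      unfolding gW using scalar_prod_self_eq_0[of "transpose_mat (W k) *\<^sub>v x" d] W[of k] x by auto
    then have "suminf g > 0"
      using g g0 by (intro suminf_pos2[of _ k]) (auto simp: sums_iff order_less_le)
    then show ?thesis using g by (simp add: sums_iff)
  qed
  have fS: "f (Suc k) = A * f k * transpose_mat A" for k
  proof -
    have "W (Suc k) = A * W k"
      unfolding W_def pow_mat_Suc_left[OF A] using A B by (intro assoc_mult_mat) auto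
    then show ?thesis
      using A W[of k] unfolding f_def
      by (simp add: transpose_mult[of _ n n _ d] assoc_mult_mat[of _ n _ _ n _ n] assoc_mult_mat[of _ n n _ d _ n] assoc_mult_mat[of _ n d _ n _ n])
  qed
  have "A * P * transpose_mat A + B * transpose_mat B = P"
  proof (rule eq_matI)
    fix i j assume "i < dim_row P" "j < dim_col P"
    then have ij: "i < n" "j < n" using P by auto
    \<comment> \<open>The rows of \<open>A\<close> serve as test vectors, which evaluates the
      shifted series as an entry of the sandwich of \<open>P\<close>; below, the same series is
      summed as the original one without its first term.\<close>
    have "(\<lambda>k. row A i \<bullet> (f k *\<^sub>v row A j)) sums (row A i \<bullet> (P *\<^sub>v row A j))"
      by (rule scalar_prod_mat_mult_sums[OF f P sm]) (use A ij in auto)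
    then have "(\<lambda>k. f (Suc k) $$ (i, j)) sums ((A * P * transpose_mat A) $$ (i, j))"
      unfolding fS by (simp only: sandwich_index[OF A f ij] sandwich_index[OF A P ij])
    moreover have "(\<lambda>k. f (Suc k) $$ (i, j)) sums (P $$ (i, j) - f 0 $$ (i, j))"
      unfolding sums_Suc_iff[of "\<lambda>k. f k $$ (i, j)"] using sm[OF ij] by simp
    ultimately have "(A * P * transpose_mat A) $$ (i, j) = P $$ (i, j) - f 0 $$ (i, j)"
      by (rule sums_unique2)
    moreover have "f 0 = B * transpose_mat B" using A B by (simp add: f_def W_def)
    ultimately show "(A * P * transpose_mat A + B * transpose_mat B) $$ (i, j) = P $$ (i, j)"
      using ij A B by simp
  qed (use A B P in auto)
  then show ?thesis using P sym pd by blast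
qed

section \<open>Hessenberg form with respect to an inner product\<close>

text \<open>The locale serves twice: for the Gramian, and for its inverse, whose inner product
  drives the Arnoldi process.\<close>

locale inner_product_mat =
  fixes n :: nat and M :: "real mat"
  assumes M[simp]: "M \<in> carrier_mat n n"
    and M_sym: "transpose_mat M = M"
    and M_pos: "\<And>x. x \<in> carrier_vec n \<Longrightarrow> x \<noteq> 0\<^sub>v n \<Longrightarrow> x \<bullet> (M *\<^sub>v x) > 0"
begin

lemma dim_M[simp]: "dim_row M = n" "dim_col M = n"
  by (rule carrier_matD[OF M])+

abbreviation ip :: "real vec \<Rightarrow> real vec \<Rightarrow> real" where
  "ip x y \<equiv> x \<bullet> (M *\<^sub>v y)"

lemma ip_commute:
  assumes "x \<in> carrier_vec n" "y \<in> carrier_vec n"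
  shows "ip x y = ip y x"
proof -
  have "ip x y = (M *\<^sub>v x) \<bullet> y"
    using transpose_vec_mult_scalar[OF M assms(2,1)] by (simp add: M_sym)
  also have "\<dots> = ip y x"
    using comm_scalar_prod[OF mult_mat_vec_carrier[OF M assms(1)] assms(2)] .
  finally show ?thesis .
qed

lemma ip_zero_right:
  assumes "x \<in> carrier_vec n"
  shows "ip x (0\<^sub>v n) = 0"
  using ip_commute[OF assms zero_carrier_vec] mult_mat_vec_carrier[OF M assms] by simp

lemma ip_diff_right:
  assumes "x \<in> carrier_vec n" "y \<in> carrier_vec n" "z \<in> carrier_vec n"
  shows "ip x (y - z) = ip x y - ip x z"
  using assms mult_mat_vec_carrier[OF M]
  by (simp add: mult_minus_distrib_mat_vec[OF M] scalar_prod_minus_distrib[of _ n])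

lemma ip_smult_right:
  assumes "x \<in> carrier_vec n" "y \<in> carrier_vec n"
  shows "ip x (c \<cdot>\<^sub>v y) = c * ip x y"
  using assms mult_mat_vec_carrier[OF M assms(2)]
  by (simp add: mult_mat_vec[OF M assms(2)])

lemma ip_smult_left:
  assumes "x \<in> carrier_vec n" "y \<in> carrier_vec n"
  shows "ip (c \<cdot>\<^sub>v x) y = c * ip x y"
  using assms mult_mat_vec_carrier[OF M assms(2)] by simp

lemma normalise:
  assumes x: "x \<in> carrier_vec n" and "x \<noteq> 0\<^sub>v n"
  defines "u \<equiv> (1 / sqrt (ip x x)) \<cdot>\<^sub>v x"
  shows "u \<in> carrier_vec n" "ip u u = 1"
proof -
  show "u \<in> carrier_vec n" using x by (simp add: u_def)
  have "ip x x > 0" using M_pos assms by blast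
  then show "ip u u = 1"
    using x by (simp add: u_def ip_smult_left ip_smult_right field_simps flip: power2_eq_square)
qed

definition orthonormal :: "nat \<Rightarrow> (nat \<Rightarrow> real vec) \<Rightarrow> bool" where
  "orthonormal k t \<longleftrightarrow> (\<forall>i<k. t i \<in> carrier_vec n) \<and>
     (\<forall>i<k. \<forall>j<k. ip (t i) (t j) = (if i = j then 1 else 0))"

text \<open>
  Membership of a vector \<open>w\<close> in the span of \<open>t\<^sub>0, \<dots>, t\<^sub>j\<close> is expressed below by duality: every
  \<open>x\<close> orthogonal to \<open>t\<^sub>0, \<dots>, t\<^sub>j\<close> is orthogonal to \<open>w\<close>.
\<close>

lemma residual:
  assumes "orthonormal k t" and w: "w \<in> carrier_vec n"
  shows "\<exists>r \<in> carrier_vec n. (\<forall>i<k. ip (t i) r = 0) \<and>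
    (\<forall>x \<in> carrier_vec n. (\<forall>i<k. ip x (t i) = 0) \<longrightarrow> ip x r = ip x w)"
  using assms(1)
proof (induction k)
  case 0
  then show ?case using w by auto
next
  case (Suc k)
  then have t: "\<And>i. i \<le> k \<Longrightarrow> t i \<in> carrier_vec n"
    and tt: "\<And>i j. i \<le> k \<Longrightarrow> j \<le> k \<Longrightarrow> ip (t i) (t j) = (if i = j then 1 else 0)"
    unfolding orthonormal_def by auto
  obtain r where r: "r \<in> carrier_vec n" "\<And>i. i < k \<Longrightarrow> ip (t i) r = 0"
    and xr: "\<And>x. x \<in> carrier_vec n \<Longrightarrow> (\<And>i. i < k \<Longrightarrow> ip x (t i) = 0) \<Longrightarrow> ip x r = ip x w"
  proof -
    have "orthonormal k t" using Suc.prems unfolding orthonormal_def by simp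
    then show ?thesis using Suc.IH that by blast
  qed
  \<comment> \<open>One Gram-Schmidt step: the correction along \<open>t k\<close> is invisible to
    every vector orthogonal to \<open>t k\<close>.\<close>
  define r' where "r' = r - ip (t k) r \<cdot>\<^sub>v t k"
  have ipr: "ip x r' = ip x r - ip (t k) r * ip x (t k)" if "x \<in> carrier_vec n" for x
    using that r(1) t[of k] by (simp add: r'_def ip_diff_right ip_smult_right)
  have "r' \<in> carrier_vec n" using r(1) t[of k] by (simp add: r'_def)
  moreover have "\<forall>i<Suc k. ip (t i) r' = 0"
    using ipr t r(2) tt by (auto simp: less_Suc_eq)
  moreover have "\<forall>x \<in> carrier_vec n. (\<forall>i<Suc k. ip x (t i) = 0) \<longrightarrow> ip x r' = ip x w"
    using ipr xr by auto
  ultimately show ?case by blast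
qed

text \<open>Fewer than \<open>n\<close> homogeneous linear conditions in \<open>n\<close> unknowns
  have a nonzero solution, which is then normalised.\<close>

lemma orthogonal_unit_vector:
  assumes k: "k < n" and t: "\<And>i. i < k \<Longrightarrow> t i \<in> carrier_vec n"
  shows "\<exists>u \<in> carrier_vec n. ip u u = 1 \<and> (\<forall>i<k. ip (t i) u = 0)"
proof -
  \<comment> \<open>Zero rows pad the system to a square matrix so that the determinant criterion
    applies. Row \<open>k\<close> vanishes, so the transpose kills the \<open>k\<close>-th unit
    vector and the determinant is 0.\<close>
  define C where "C = mat n n (\<lambda>(i, j). if i < k then (M *\<^sub>v t i) $ j else 0)"
  have C: "C \<in> carrier_mat n n" by (auto simp: C_def)
  have "row C k = 0\<^sub>v n" using k by (intro eq_vecI) (auto simp: C_def)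
  then have "transpose_mat C *\<^sub>v unit_vec n k = 0\<^sub>v n"
    using k C by (intro eq_vecI) (auto simp: C_def)
  moreover have "unit_vec n k \<noteq> (0\<^sub>v n :: real vec)"
    using k by (metis index_unit_vec(1) index_zero_vec(1) zero_neq_one)
  ultimately have "det (transpose_mat C) = 0"
    using C k by (subst det_0_iff_vec_prod_zero[of _ n]) (auto intro: exI[of _ "unit_vec n k"])
  then have "det C = 0" by (simp add: det_transpose[OF C])
  then obtain v where v: "v \<in> carrier_vec n" "v \<noteq> 0\<^sub>v n" "C *\<^sub>v v = 0\<^sub>v n"
    using det_0_iff_vec_prod_zero[OF C] by auto
  have "ip (t i) v = 0" if i: "i < k" for i
  proof -
    have "row C i = M *\<^sub>v t i"
      using i k by (intro eq_vecI) (auto simp: C_def)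
    then have "(M *\<^sub>v t i) \<bullet> v = 0"
      using arg_cong[OF v(3), of "\<lambda>y. y $ i"] i k C by simp
    then show ?thesis
      using transpose_vec_mult_scalar[OF M v(1) t[OF i]] by (simp add: M_sym)
  qed
  then show ?thesis
    using normalise[OF v(1,2)] v(1) t by (intro bexI[of _ "(1 / sqrt (ip v v)) \<cdot>\<^sub>v v"])
      (auto simp: ip_smult_right)
qed

text \<open>One step of the Arnoldi process: \<open>u\<close> is the normalised residual of
  \<open>w\<close>, or any new unit vector if the residual vanishes. The last clause is the dual
  form of \<open>w\<close> lying in the span of the old vectors and \<open>u\<close>.\<close>

lemma orthonormal_extension:
  assumes k: "k < n" and on: "orthonormal k t" and w: "w \<in> carrier_vec n"
  shows "\<exists>u \<in> carrier_vec n. ip u u = 1 \<and> (\<forall>i<k. ip (t i) u = 0) \<and> ip u w \<ge> 0 \<and>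
    (\<forall>x \<in> carrier_vec n. (\<forall>i<k. ip x (t i) = 0) \<longrightarrow> ip x u = 0 \<longrightarrow> ip x w = 0)"
proof -
  have t: "\<And>i. i < k \<Longrightarrow> t i \<in> carrier_vec n" using on unfolding orthonormal_def by auto
  obtain r where r: "r \<in> carrier_vec n" "\<And>i. i < k \<Longrightarrow> ip (t i) r = 0"
    and xr: "\<And>x. x \<in> carrier_vec n \<Longrightarrow> (\<And>i. i < k \<Longrightarrow> ip x (t i) = 0) \<Longrightarrow> ip x r = ip x w"
    using residual[OF on w] by blast
  show ?thesis
  proof (cases "r = 0\<^sub>v n")
    \<comment> \<open>Breakdown: \<open>w\<close> already lies in the span of the old vectors, so
      every admissible \<open>u\<close> is orthogonal to it.\<close>
    case True
    then have z: "ip x w = 0" if "x \<in> carrier_vec n" "\<And>i. i < k \<Longrightarrow> ip x (t i) = 0" for x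
      using xr[OF that] ip_zero_right[OF that(1)] by simp
    obtain u where u: "u \<in> carrier_vec n" "ip u u = 1" "\<And>i. i < k \<Longrightarrow> ip (t i) u = 0"
      using orthogonal_unit_vector[OF k, of t] t by blast
    have "ip u (t i) = 0" if "i < k" for i
      using ip_commute[OF u(1) t[OF that]] u(3)[OF that] by simp
    then have "ip u w = 0" using z[OF u(1)] by simp
    then show ?thesis using u z by (intro bexI[of _ u] conjI allI ballI impI) simp_all
  next
    case False
    define c where "c = 1 / sqrt (ip r r)"
    have c: "c > 0" using M_pos[OF r(1) False] by (simp add: c_def)
    define u where "u = c \<cdot>\<^sub>v r"
    have u: "u \<in> carrier_vec n" "ip u u = 1"
      using normalise[OF r(1) False] unfolding u_def c_def by auto
    have xu: "ip x u = c * ip x r" if "x \<in> carrier_vec n" for x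
      using that r(1) by (simp add: u_def ip_smult_right)
    have tu: "ip (t i) u = 0" if "i < k" for i using xu t r(2) that by simp
    have "ip u (t i) = 0" if "i < k" for i
      using ip_commute[OF u(1) t[OF that]] tu[OF that] by simp
    \<comment> \<open>Since \<open>w\<close> and its residual differ only by old vectors,
      \<open>u\<close> sees the same product with both; this product is a positive multiple of
      \<open>ip r r\<close>.\<close>
    then have "ip u w = ip u r" using xr[OF u(1)] by simp
    moreover have "ip u r = c * ip r r" using r(1) by (simp add: u_def ip_smult_left)
    ultimately have "ip u w \<ge> 0" using c M_pos[OF r(1) False] by simp
    moreover have "ip x w = 0"
      if "x \<in> carrier_vec n" "\<forall>i<k. ip x (t i) = 0" "ip x u = 0" for x
    proof -
      have "ip x r = 0" using xu[OF that(1)] that(3) c by simp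
      then show ?thesis using xr[OF that(1)] that(2) by simp
    qed
    ultimately show ?thesis using u tu by blast
  qed
qed

text \<open>Treating \<open>b\<close> as the vector fed in at step 0 and
  \<open>F *\<^sub>v t i\<close> as the one fed in at step \<open>Suc i\<close> lets one induction
  yield both the first column of the new \<open>B\<close> and the Hessenberg columns of the new
  \<open>A\<close>.\<close>

lemma arnoldi_basis:
  assumes F: "F \<in> carrier_mat n n" and b: "b \<in> carrier_vec n" and "k \<le> n"
  shows "\<exists>t. orthonormal k t \<and> (\<forall>j<k. let w = (case j of 0 \<Rightarrow> b | Suc i \<Rightarrow> F *\<^sub>v t i) in
    ip (t j) w \<ge> 0 \<and> (\<forall>x \<in> carrier_vec n. (\<forall>i\<le>j. ip x (t i) = 0) \<longrightarrow> ip x w = 0))"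
  using assms(3)
proof (induction k)
  case 0
  then show ?case by (simp add: orthonormal_def)
next
  case (Suc k)
  define w where "w t j = (case j of 0 \<Rightarrow> b | Suc i \<Rightarrow> F *\<^sub>v t i)" for t :: "nat \<Rightarrow> real vec" and j
  obtain t where on: "orthonormal k t"
    and t: "\<And>j. j < k \<Longrightarrow> ip (t j) (w t j) \<ge> 0"
    "\<And>j x. j < k \<Longrightarrow> x \<in> carrier_vec n \<Longrightarrow> (\<forall>i\<le>j. ip x (t i) = 0) \<Longrightarrow> ip x (w t j) = 0"
    using Suc.IH[OF Suc_leD[OF Suc.prems]] unfolding Let_def w_def[symmetric] by blast
  have tc: "t i \<in> carrier_vec n" if "i < k" for i using on that unfolding orthonormal_def by auto
  have "w t k \<in> carrier_vec n"
    using b F tc unfolding w_def by (auto split: nat.split)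
  then obtain u where u: "u \<in> carrier_vec n" "ip u u = 1" "\<And>i. i < k \<Longrightarrow> ip (t i) u = 0"
    "ip u (w t k) \<ge> 0"
    "\<And>x. x \<in> carrier_vec n \<Longrightarrow> \<forall>i<k. ip x (t i) = 0 \<Longrightarrow> ip x u = 0 \<Longrightarrow> ip x (w t k) = 0"
    using orthonormal_extension[OF _ on, of "w t k"] Suc.prems by (auto simp: Suc_le_eq)
  define t' where "t' = t(k := u)"
  have t'[simp]: "t' k = u" "\<And>i. i \<noteq> k \<Longrightarrow> t' i = t i" by (auto simp: t'_def)
  \<comment> \<open>The vector fed in at step \<open>j\<close> depends on \<open>t\<close> only at
    index \<open>j - 1\<close>, which is below \<open>k\<close>, so the update at \<open>k\<close>
    does not change it.\<close>
  have w'[simp]: "w t' j = w t j" if "j \<le> k" for j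
    using that unfolding w_def by (auto split: nat.split)
  have "ip u (t i) = 0" if "i < k" for i using u(3)[OF that] ip_commute[OF u(1) tc[OF that]] by simp
  then have "orthonormal (Suc k) t'"
    using on u unfolding orthonormal_def by (auto simp: less_Suc_eq)
  moreover have "ip (t' j) (w t' j) \<ge> 0" if "j < Suc k" for j
    using that t(1) u(4) by (cases "j = k") auto
  moreover have "ip x (w t' j) = 0"
    if "j < Suc k" "x \<in> carrier_vec n" "\<forall>i\<le>j. ip x (t' i) = 0" for x j
  proof (cases "j = k")
    case True
    have "ip x (t i) = 0" if "i < k" for i
      using \<open>\<forall>i\<le>j. ip x (t' i) = 0\<close>[rule_format, of i] that True by simp
    moreover have "ip x u = 0" using that(3)[rule_format, of k] True by simp
    ultimately show ?thesis using u(5)[OF that(2)] True by simp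
  next
    case False
    then have j: "j < k" using that(1) by simp
    have "ip x (t i) = 0" if "i \<le> j" for i
      using \<open>\<forall>i\<le>j. ip x (t' i) = 0\<close>[rule_format, of i] that j by simp
    then show ?thesis using t(2)[OF j that(2)] j by simp
  qed
  ultimately have "orthonormal (Suc k) t' \<and> (\<forall>j<Suc k. ip (t' j) (w t' j) \<ge> 0 \<and>
      (\<forall>x \<in> carrier_vec n. (\<forall>i\<le>j. ip x (t' i) = 0) \<longrightarrow> ip x (w t' j) = 0))"
    by simp
  then show ?case unfolding Let_def w_def by (rule exI[of _ t'])
qed

end

text \<open>Positivity rules out a kernel, so \<open>P\<close> is invertible. The transpose of the
  inverse is again an inverse, which gives symmetry, and substituting
  \<open>y = M *\<^sub>v x\<close> turns the form of \<open>M\<close> into that of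
  \<open>P\<close>.\<close>

lemma inverse_inner_product_mat:
  fixes P :: "real mat"
  assumes "inner_product_mat n P"
  shows "\<exists>M. inner_product_mat n M \<and> P * M = 1\<^sub>m n \<and> M * P = 1\<^sub>m n"
proof -
  interpret P: inner_product_mat n P by fact
  have "det P \<noteq> 0"
  proof
    assume "det P = 0"
    then obtain v where v: "v \<in> carrier_vec n" "v \<noteq> 0\<^sub>v n" "P *\<^sub>v v = 0\<^sub>v n"
      using det_0_iff_vec_prod_zero[OF P.M] by auto
    then show False using P.M_pos[OF v(1,2)] by simp
  qed
  then obtain M where M: "M \<in> carrier_mat n n" and MP: "M * P = 1\<^sub>m n" and PM: "P * M = 1\<^sub>m n"
    using det_non_zero_imp_unit[OF P.M, of "()"] unfolding Units_def ring_mat_def by auto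
  have "transpose_mat M * P = 1\<^sub>m n"
    using arg_cong[OF PM, of transpose_mat] M P.M P.M_sym by (simp add: transpose_mult[of _ n n _ n])
  then have "transpose_mat M * (P * M) = M"
    using M P.M by (simp add: assoc_mult_mat[of _ n n _ n _ n, symmetric])
  then have sym: "transpose_mat M = M" using M PM by simp
  have "x \<bullet> (M *\<^sub>v x) > 0" if x: "x \<in> carrier_vec n" "x \<noteq> 0\<^sub>v n" for x
  proof -
    define y where "y = M *\<^sub>v x"
    have y: "y \<in> carrier_vec n" using M x by (simp add: y_def)
    have "P *\<^sub>v y = x"
      using M x PM P.M by (simp add: y_def assoc_mult_mat_vec[of _ n n _ n, symmetric])
    moreover have "P *\<^sub>v 0\<^sub>v n = 0\<^sub>v n" using P.M by (intro eq_vecI) auto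
    ultimately have "P *\<^sub>v y = x" "y \<noteq> 0\<^sub>v n" using x by auto
    then have "y \<bullet> x > 0" using P.M_pos[OF y] by simp
    then show ?thesis using comm_scalar_prod[OF y x(1)] by (simp add: y_def)
  qed
  then have "inner_product_mat n M" using M sym by unfold_locales auto
  then show ?thesis using MP PM by blast
qed

section \<open>Change of basis to the Arnoldi vectors\<close>

theorem theorem2p3:
  fixes n d :: nat and A B :: "real mat"
  assumes "n \<ge> 1"
    and "input_pair n d A B"
    and "stable_mat A"
    and "controllable n A B"
  shows "\<exists>A' B'. input_pair n d A' B' \<and> equivalent_pairs n A B A' B' \<and>
           HIN_pair n A' B' \<and> standard_pair n A' B'"
proof -
  have A: "A \<in> carrier_mat n n" and B: "B \<in> carrier_mat n d"
    using assms(2) unfolding input_pair_def by auto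
  have n: "n > 0" using assms(1) by simp
  \<comment> \<open>A first column of \<open>B\<close> must exist to start the process. For
    \<open>d = 0\<close> the orthogonality condition is an equation between empty vectors, so every
    vector would have to be zero.\<close>
  have d: "d > 0"
  proof (rule ccontr)
    assume "\<not> d > 0"
    then have "unit_vec n 0 = (0\<^sub>v n :: real vec)"
      using A B by (intro controllable_left_kernel[OF A B assms(4)]) auto
    then show False using n by (metis index_unit_vec(1) index_zero_vec(1) zero_neq_one)
  qed
  obtain P where "inner_product_mat n P"
    and stein: "A * P * transpose_mat A + B * transpose_mat B = P"
    using controllability_gramian[OF n A B assms(3,4)] unfolding inner_product_mat_def by blast
  then obtain M where "inner_product_mat n M" and PM: "P * M = 1\<^sub>m n" and MP: "M * P = 1\<^sub>m n"
    and P: "P \<in> carrier_mat n n"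
    using inverse_inner_product_mat unfolding inner_product_mat_def by blast
  then interpret inner_product_mat n M by simp
  define b where "b = col B 0"
  have b: "b \<in> carrier_vec n" using B d by (auto simp: b_def)
  obtain t where on: "orthonormal n t"
    and t: "\<And>j. j < n \<Longrightarrow> ip (t j) (case j of 0 \<Rightarrow> b | Suc i \<Rightarrow> A *\<^sub>v t i) \<ge> 0"
      "\<And>j x. j < n \<Longrightarrow> x \<in> carrier_vec n \<Longrightarrow> \<forall>i\<le>j. ip x (t i) = 0 \<Longrightarrow>
        ip x (case j of 0 \<Rightarrow> b | Suc i \<Rightarrow> A *\<^sub>v t i) = 0"
    using arnoldi_basis[OF A b order_refl] unfolding Let_def by blast
  have tc: "\<And>i. i < n \<Longrightarrow> t i \<in> carrier_vec n"
    and tt: "\<And>i j. i < n \<Longrightarrow> j < n \<Longrightarrow> ip (t i) (t j) = (if i = j then 1 else 0)"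
    using on unfolding orthonormal_def by auto
  define T where "T = mat_of_cols n (map t [0..<n])"
  \<comment> \<open>Orthonormality of the columns of \<open>T\<close> says exactly that this matrix
    is a left inverse of \<open>T\<close>.\<close>
  define S where "S = transpose_mat T * M"
  have T: "T \<in> carrier_mat n n" by (auto simp: T_def)
  have S: "S \<in> carrier_mat n n" using T by (auto simp: S_def)
  have colT: "col T j = t j" if "j < n" for j
    using that tc by (simp add: T_def)
  \<comment> \<open>Multiplying by \<open>S\<close> on the left reads off coordinates in the basis
    \<open>t\<close>, so entries of the new pair become inner products.\<close>
  have SX: "(S * X) $$ (i, j) = ip (t i) (col X j)"
    if "X \<in> carrier_mat n m" "i < n" "j < m" for X i j m
  proof -
    have "S * X = transpose_mat T * (M * X)"
      unfolding S_def using T that by (intro assoc_mult_mat) auto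
    then show ?thesis using that T by (simp add: colT col_mult2[OF M that(1,3)])
  qed
  have ST: "S * T = 1\<^sub>m n"
  proof (rule eq_matI)
    fix i j assume "i < dim_row (1\<^sub>m n :: real mat)" "j < dim_col (1\<^sub>m n :: real mat)"
    then have ij: "i < n" "j < n" by auto
    then show "(S * T) $$ (i, j) = 1\<^sub>m n $$ (i, j)"
      unfolding SX[OF T ij] colT[OF ij(2)] tt[OF ij] by simp
  qed (use S T in auto)
  have TS: "T * S = 1\<^sub>m n" by (rule mat_mult_left_right_inverse[OF S T ST])
  have TT: "T * transpose_mat T = P"
  proof -
    have "T * transpose_mat T = T * transpose_mat T * (M * P)" using T MP by simp
    also have "\<dots> = T * S * P"
      unfolding S_def using T P
      by (simp add: assoc_mult_mat[of _ n n _ n _ n] mult_carrier_mat[of _ n n])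
    finally show ?thesis using TS P by simp
  qed
  define A' where "A' = S * A * T"
  define B' where "B' = S * B"
  have A': "A' \<in> carrier_mat n n" and B': "B' \<in> carrier_mat n d"
    using S A T B by (auto simp: A'_def B'_def)
  have A'_ij: "A' $$ (i, j) = ip (t i) (A *\<^sub>v t j)" if "i < n" "j < n" for i j
  proof -
    have "A' = S * (A * T)" unfolding A'_def using S A T by (rule assoc_mult_mat)
    moreover have "col (A * T) j = A *\<^sub>v t j"
      unfolding col_mult2[OF A T that(2)] colT[OF that(2)] ..
    ultimately show ?thesis using SX[of "A * T" n i j] that A T by (simp del: col_mult2)
  qed
  have B'_i0: "B' $$ (i, 0) = ip (t i) b" if "i < n" for i
    unfolding B'_def b_def by (rule SX[OF B that d])
  have normal: "input_normal n A' B'"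
  proof -
    \<comment> \<open>Both products are brought to the form \<open>S * X * transpose_mat S\<close>,
      so that their sum contains the left side of the Stein equation.\<close>
    have "A' * transpose_mat A' = S * (A * (T * transpose_mat T) * transpose_mat A) * transpose_mat S"
      unfolding A'_def using S A T
      by (simp add: transpose_mult[of _ n n _ n] assoc_mult_mat[of _ n n _ n _ n])
    moreover have "B' * transpose_mat B' = S * (B * transpose_mat B) * transpose_mat S"
      unfolding B'_def using S B
      by (simp add: transpose_mult[of _ n n _ d] assoc_mult_mat[of _ n n _ d _ n]
          assoc_mult_mat[of _ n n _ n _ n] assoc_mult_mat[of _ n d _ n _ n])
    ultimately have "A' * transpose_mat A' + B' * transpose_mat B'
        = S * (A * P * transpose_mat A + B * transpose_mat B) * transpose_mat S"
      unfolding TT using S A B P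
      by (simp add: mult_add_distrib_mat[of _ n n _ n] add_mult_distrib_mat[of _ n n _ _ n])
    also have "\<dots> = (S * T) * transpose_mat (S * T)"
      unfolding stein unfolding TT[symmetric] using S T
      by (simp add: transpose_mult[of _ n n _ n] assoc_mult_mat[of _ n n _ n _ n])
    finally show ?thesis unfolding input_normal_def by (simp add: ST)
  qed
  have "hessenberg_mat n A'"
    unfolding hessenberg_mat_def
  proof (intro allI impI)
    fix i j assume ij: "i < n" "j < n" "i > j + 1"
    \<comment> \<open>Step \<open>Suc j\<close> puts \<open>A *\<^sub>v t j\<close> into the span of
      the vectors up to index \<open>j + 1\<close>, and \<open>t i\<close> is orthogonal to all of
      these because \<open>i > j + 1\<close>.\<close>
    have "ip (t i) (case Suc j of 0 \<Rightarrow> b | Suc i \<Rightarrow> A *\<^sub>v t i) = 0"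
      by (rule t(2)) (use ij tc tt in auto)
    then show "A' $$ (i, j) = 0" using ij by (simp add: A'_ij)
  qed
  moreover have B00: "B' $$ (0, 0) \<ge> 0" using t(1)[of 0] n by (simp add: B'_i0)
  moreover have "B' $$ (j, 0) = 0" if "j < n" "j > 0" for j
  proof -
    have "ip (t j) (case 0 of 0 \<Rightarrow> b | Suc i \<Rightarrow> A *\<^sub>v t i) = 0"
      by (rule t(2)) (use that tc tt in auto)
    then show ?thesis using that by (simp add: B'_i0)
  qed
  ultimately have hess: "hessenberg_pair n A' B'" unfolding hessenberg_pair_def by blast
  have sub: "A' $$ (i + 1, i) \<ge> 0" if "i + 1 < n" for i
    using t(1)[of "Suc i"] that by (simp add: A'_ij)
  have "B' $$ (0, 0) \<le> 1"
  proof -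
    \<comment> \<open>The corner entry of the normality equation says that the squares in the first
      rows of \<open>A'\<close> and \<open>B'\<close> add up to 1.\<close>
    have "(A' * transpose_mat A' + B' * transpose_mat B') $$ (0, 0) = 1"
      using normal n unfolding input_normal_def by simp
    then have "row A' 0 \<bullet> row A' 0 + row B' 0 \<bullet> row B' 0 = 1"
      using A' B' n by simp
    moreover have "(B' $$ (0, 0))\<^sup>2 \<le> row B' 0 \<bullet> row B' 0"
    proof -
      have "(\<Sum>j\<in>{0}. row B' 0 $ j * row B' 0 $ j) \<le> (\<Sum>j\<in>{0..<d}. row B' 0 $ j * row B' 0 $ j)"
        using d by (intro sum_mono2) auto
      then show ?thesis using B' n d by (simp add: scalar_prod_def power2_eq_square)
    qed
    ultimately have "(B' $$ (0, 0))\<^sup>2 \<le> 1\<^sup>2" using scalar_prod_self_nonneg[of "row A' 0"] by simp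
    then show ?thesis by (rule power2_le_imp_le) simp
  qed
  with hess sub B00 have "standard_pair n A' B'" unfolding standard_pair_def by blast
  moreover have "equivalent_pairs n A B A' B'"
    unfolding equivalent_pairs_def inverts_mat_def
    using T S ST TS by (intro bexI[of _ T] bexI[of _ S]) (auto simp: A'_def B'_def)
  moreover have "input_pair n d A' B'" using A' B' by (simp add: input_pair_def)
  ultimately show ?thesis using hess normal unfolding HIN_pair_def by blast
qed

end
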